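(* Let $G=(V,E)$ be a finite graph with $n=|V|\ge1$, and let $F(x)=n!\,P_G(x)$. For $k\ge 0$ let $A_k$ be the number of bijections $\pi:V\to\{1,\dots,n\}$ having exactly $k$ bad vertices. Then for every $k\ge 0$, $$A_k=\frac{F^{(k)}(-1)}{k!}.$$ In particular $A_0=\sigma(G)$, the number of successive vertex orderings of $G$.
   Context: For a bijection $\pi:V\to\{1,\dots,n\}$, a vertex $v$ is bad if $\pi(v)\ne1$ and $\pi(v)<\pi(u)$ for every neighbour $u$ of $v$. An ordering is successive if it has no bad vertex. For $I\subseteq V$ let $N(I)$ be the set of vertices adjacent to some vertex of $I$ and $a(I)=n-|I|-|N(I)|$. For independent sets $I$ (no two vertices adjacent) define $b(\varnothing)=1$ and $b(I)=\frac{1}{n-a(I)}\sum_{v\in I}b(I\setminus\{v\})$ for $I\ne\varnothing$, and $w(I)=\frac{a(I)}{n}b(I)$. The successive ordering polynomial is $P_G(x)=\sum_{I\ \text{independent}} w(I)\,x^{|I|}$. *)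

theory Defs
  imports
    Complex_Main
    "HOL-Library.FuncSet"
    "HOL-Computational_Algebra.Polynomial"
begin

definition finite_graph :: "'a set \<Rightarrow> 'a set set \<Rightarrow> bool" where
  "finite_graph V E \<longleftrightarrow> finite V \<and> (\<forall>e\<in>E. e \<subseteq> V \<and> card e = 2)"

definition adjacent :: "'a set set \<Rightarrow> 'a \<Rightarrow> 'a \<Rightarrow> bool" where
  "adjacent E u v \<longleftrightarrow> {u, v} \<in> E"

text \<open>Orderings are extensional functions, so that each bijection from \<open>V\<close> is counted once.\<close>

definition orderings :: "'a set \<Rightarrow> ('a \<Rightarrow> nat) set" where
  "orderings V = {\<pi> \<in> V \<rightarrow>\<^sub>E {1..card V}. bij_betw \<pi> V {1..card V}}"

definition bad_vertices :: "'a set \<Rightarrow> 'a set set \<Rightarrow> ('a \<Rightarrow> nat) \<Rightarrow> 'a set" where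
  "bad_vertices V E \<pi> =
     {v \<in> V. \<pi> v \<noteq> 1 \<and> (\<forall>u\<in>V. adjacent E u v \<longrightarrow> \<pi> v < \<pi> u)}"

definition successive :: "'a set \<Rightarrow> 'a set set \<Rightarrow> ('a \<Rightarrow> nat) \<Rightarrow> bool" where
  "successive V E \<pi> \<longleftrightarrow> bad_vertices V E \<pi> = {}"

definition num_successive :: "'a set \<Rightarrow> 'a set set \<Rightarrow> nat" where
  "num_successive V E = card {\<pi> \<in> orderings V. successive V E \<pi>}"

definition num_orderings_bad :: "'a set \<Rightarrow> 'a set set \<Rightarrow> nat \<Rightarrow> nat" where
  "num_orderings_bad V E k = card {\<pi> \<in> orderings V. card (bad_vertices V E \<pi>) = k}"

definition nbhd :: "'a set \<Rightarrow> 'a set set \<Rightarrow> 'a set \<Rightarrow> 'a set" where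
  "nbhd V E I = {u \<in> V. \<exists>v\<in>I. adjacent E u v}"

definition independent_sets :: "'a set \<Rightarrow> 'a set set \<Rightarrow> 'a set set" where
  "independent_sets V E = {I. I \<subseteq> V \<and> (\<forall>u\<in>I. \<forall>v\<in>I. \<not> adjacent E u v)}"

definition acoef :: "'a set \<Rightarrow> 'a set set \<Rightarrow> 'a set \<Rightarrow> real" where
  "acoef V E I = real (card V) - real (card I) - real (card (nbhd V E I))"

text \<open>The guard for infinite \<open>I\<close> only serves termination; see \<open>bcoef_rec\<close> below.\<close>

function bcoef :: "'a set \<Rightarrow> 'a set set \<Rightarrow> 'a set \<Rightarrow> real" where
  "bcoef V E I =
     (if I = {} then 1
      else if infinite I then 0
      else 1 / (real (card V) - acoef V E I) * (\<Sum>v\<in>I. bcoef V E (I - {v})))"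
  by pat_completeness auto
termination
  by (relation "measure (\<lambda>(V, E, I). card I)") (auto simp: card_gt_0_iff)

declare bcoef.simps [simp del]

lemma bcoef_empty: "bcoef V E {} = 1"
  by (simp add: bcoef.simps)

lemma bcoef_rec:
  assumes "I \<noteq> {}"
  shows "bcoef V E I = 1 / (real (card V) - acoef V E I) * (\<Sum>v\<in>I. bcoef V E (I - {v}))"
  using assms by (subst bcoef.simps) auto

definition wcoef :: "'a set \<Rightarrow> 'a set set \<Rightarrow> 'a set \<Rightarrow> real" where
  "wcoef V E I = acoef V E I / real (card V) * bcoef V E I"

definition successive_poly :: "'a set \<Rightarrow> 'a set set \<Rightarrow> real poly" where
  "successive_poly V E = (\<Sum>I\<in>independent_sets V E. monom (wcoef V E I) (card I))"

end

theory Submission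
  imports Defs
begin

text \<open>
  For an independent set \<open>I\<close>, exactly \<open>n! w(I)\<close> orderings have all vertices of \<open>I\<close> bad. To see
  this, remove the first vertex \<open>x\<close> of an ordering in which every vertex of \<open>I\<close> precedes its
  neighbours: \<open>x\<close> is not in \<open>N(I)\<close>, and what remains is such an ordering of \<open>V - {x}\<close> for
  \<open>I - {x}\<close>. As the weights \<open>b\<close> do not change when vertices outside \<open>N(I)\<close> are deleted, induction
  gives \<open>n! b(I)\<close> orderings of this kind; all of \<open>I\<close> is bad if moreover \<open>x\<close> is not in \<open>I\<close>, which
  leaves \<open>a(I)\<close> choices for \<open>x\<close>. Since the bad vertices of an ordering form an independent set,
  exchanging the sums over \<open>I\<close> and over the orderings \<open>\<pi>\<close> shows that \<open>F(x)\<close> is the sum of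
  \<open>(1 + x) ^ card (bad_vertices V E \<pi>)\<close> over all \<open>\<pi>\<close>, and \<open>A_k\<close> is its Taylor coefficient at \<open>-1\<close>.
\<close>

section \<open>Neighbourhoods, independent sets and the weights\<close>

lemma adjacent_commute: "adjacent E u v \<longleftrightarrow> adjacent E v u"
  by (simp add: adjacent_def insert_commute)

lemma finite_nbhd: "finite V \<Longrightarrow> finite (nbhd V E I)"
  by (simp add: nbhd_def)

lemma nbhd_mono: "J \<subseteq> I \<Longrightarrow> nbhd V E J \<subseteq> nbhd V E I"
  by (auto simp: nbhd_def)

lemma nbhd_Diff_vertex:
  assumes "x \<notin> nbhd V E I"
  shows "nbhd (V - {x}) E I = nbhd V E I"
  using assms by (auto simp: nbhd_def)

lemma independent_sets_mono:
  "I \<in> independent_sets V E \<Longrightarrow> J \<subseteq> I \<Longrightarrow> J \<in> independent_sets V E"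
  by (auto simp: independent_sets_def)

lemma independent_sets_Diff:
  "I \<in> independent_sets V E \<Longrightarrow> I - {x} \<in> independent_sets (V - {x}) E"
  by (auto simp: independent_sets_def)

lemma independent_sets_disjoint_nbhd:
  "I \<in> independent_sets V E \<Longrightarrow> I \<inter> nbhd V E I = {}"
  by (auto simp: independent_sets_def nbhd_def)

lemma finite_independent_sets: "finite V \<Longrightarrow> finite (independent_sets V E)"
  by (rule finite_subset[of _ "Pow V"]) (auto simp: independent_sets_def)

text \<open>The recursion sees \<open>V\<close> only through n - a(J) = |J| + |N(J)| for subsets J
  of \<open>I\<close>, and no such N(J) contains \<open>x\<close>.\<close>

lemma bcoef_Diff_vertex:
  assumes "finite I" "x \<notin> nbhd V E I"
  shows "bcoef (V - {x}) E I = bcoef V E I"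
  using assms
proof (induction "card I" arbitrary: I rule: less_induct)
  case less
  show ?case
  proof (cases "I = {}")
    case False
    have "bcoef (V - {x}) E (I - {v}) = bcoef V E (I - {v})" if "v \<in> I" for v
    proof (rule less.hyps)
      show "card (I - {v}) < card I"
        using that less.prems(1) by (rule card_Diff1_less[rotated])
      show "x \<notin> nbhd V E (I - {v})"
        using less.prems(2) nbhd_mono[of "I - {v}" I V E] by blast
    qed (use less.prems in simp)
    then show ?thesis
      using False less.prems by (simp add: bcoef_rec acoef_def nbhd_Diff_vertex)
  qed (simp add: bcoef_empty)
qed

text \<open>Independence makes \<open>I\<close> and N(I) disjoint, so a(I) is a true count.\<close>

lemma card_free_vertices:
  assumes "finite V" "I \<in> independent_sets V E"
  shows "real (card (V - I - nbhd V E I)) = acoef V E I"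
proof -
  have sub: "I \<union> nbhd V E I \<subseteq> V" and fin: "finite I"
    using assms finite_subset by (auto simp: independent_sets_def nbhd_def)
  have "card (I \<union> nbhd V E I) = card I + card (nbhd V E I)"
    using fin finite_nbhd[OF assms(1)] independent_sets_disjoint_nbhd[OF assms(2)]
    by (rule card_Un_disjoint)
  moreover have "card (V - (I \<union> nbhd V E I)) + card (I \<union> nbhd V E I) = card V"
    using sub assms(1) by (metis card_Diff_subset card_mono finite_subset le_add_diff_inverse2)
  moreover have "V - I - nbhd V E I = V - (I \<union> nbhd V E I)" by blast
  ultimately show ?thesis by (simp add: acoef_def)
qed

text \<open>Badness of all of \<open>I\<close> without the condition
  \<open>\<pi> v \<noteq> 1\<close>. Unlike badness, this survives deletion of the first vertex,
  which makes the induction possible.\<close>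

definition dominating_orderings :: "'a set \<Rightarrow> 'a set set \<Rightarrow> 'a set \<Rightarrow> ('a \<Rightarrow> nat) set" where
  "dominating_orderings V E I =
     {\<pi> \<in> orderings V. \<forall>v\<in>I. \<forall>u\<in>V. adjacent E u v \<longrightarrow> \<pi> v < \<pi> u}"

section \<open>Splitting orderings by their first vertex\<close>

lemma finite_orderings: "finite V \<Longrightarrow> finite (orderings V)"
  by (rule finite_subset[of _ "V \<rightarrow>\<^sub>E {1..card V}"]) (auto simp: orderings_def intro: finite_PiE)

lemma orderings_pos: "\<pi> \<in> orderings V \<Longrightarrow> v \<in> V \<Longrightarrow> 0 < \<pi> v"
  by (auto simp: orderings_def dest!: PiE_mem)

lemma ordering_first_unique:
  assumes "\<pi> \<in> orderings V" "V \<noteq> {}" "finite V"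
  shows "\<exists>!x. x \<in> V \<and> \<pi> x = 1"
proof -
  have b: "bij_betw \<pi> V {1..card V}" using assms(1) by (simp add: orderings_def)
  have "1 \<in> {1..card V}" using assms by (simp add: Suc_le_eq card_gt_0_iff)
  then obtain x where "x \<in> V" "\<pi> x = 1"
    using b by (metis bij_betw_imp_surj_on imageE)
  moreover have "inj_on \<pi> V" using b by (rule bij_betw_imp_inj_on)
  ultimately show ?thesis by (metis inj_onD)
qed

lemma card_orderings_by_first:
  assumes "finite V" "V \<noteq> {}" "A \<subseteq> orderings V"
  shows "card A = (\<Sum>x\<in>V. card {\<pi> \<in> A. \<pi> x = 1})"
proof -
  have fin: "finite A" using assms finite_orderings finite_subset by blast
  have "A = (\<Union>x\<in>V. {\<pi> \<in> A. \<pi> x = 1})"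
    using ordering_first_unique[OF _ assms(2,1)] assms(3) by blast
  then have "card A = card (\<Union>x\<in>V. {\<pi> \<in> A. \<pi> x = 1})" by simp
  also have "\<dots> = (\<Sum>x\<in>V. card {\<pi> \<in> A. \<pi> x = 1})"
    using assms(1,3) fin ordering_first_unique[OF _ assms(2,1)]
    by (intro card_UN_disjoint) (simp, simp, blast)
  finally show ?thesis .
qed

text \<open>The inverse puts \<open>x\<close> in front. This respects all constraints: since
  \<open>x\<close> is not in N(I), none asks a member of \<open>I\<close> to precede
  \<open>x\<close>; and if \<open>x\<close> lies in \<open>I\<close>, being first satisfies its own
  constraints.\<close>

lemma bij_betw_dominating_orderings_first:
  assumes "finite V" "x \<in> V" "x \<notin> nbhd V E I" "I \<subseteq> V"
  shows "bij_betw (\<lambda>\<pi>. \<lambda>v\<in>V - {x}. \<pi> v - 1)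
           {\<pi> \<in> dominating_orderings V E I. \<pi> x = 1}
           (dominating_orderings (V - {x}) E (I - {x}))"
proof (rule bij_betw_byWitness[where f' = "\<lambda>\<sigma>. \<lambda>v\<in>V. if v = x then 1 else \<sigma> v + 1"])
  obtain n where n: "card V = Suc n" "card (V - {x}) = n"
    using assms by (metis card_Suc_Diff1)
  \<comment> \<open>Labels off \<open>x\<close> are at least 2, so \<open>\<pi> v - 1\<close> is
    never truncated and strict inequalities survive the shift.\<close>
  have gt1: "1 < \<pi> v" if "\<pi> \<in> orderings V" "\<pi> x = 1" "v \<in> V" "v \<noteq> x" for \<pi> v
  proof -
    have "\<pi> v \<noteq> 1" using ordering_first_unique[OF that(1) _ assms(1)] that assms by auto
    then show ?thesis using orderings_pos[OF that(1,3)] by simp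
  qed
  show "\<forall>\<pi>\<in>{\<pi> \<in> dominating_orderings V E I. \<pi> x = 1}.
    (\<lambda>v\<in>V. if v = x then 1 else (\<lambda>v\<in>V - {x}. \<pi> v - 1) v + 1) = \<pi>"
  proof
    fix \<pi> assume "\<pi> \<in> {\<pi> \<in> dominating_orderings V E I. \<pi> x = 1}"
    then have p: "\<pi> \<in> orderings V" "\<pi> x = 1" by (auto simp: dominating_orderings_def)
    then have "\<pi> \<in> extensional V" by (auto simp: orderings_def PiE_def)
    then show "(\<lambda>v\<in>V. if v = x then 1 else (\<lambda>v\<in>V - {x}. \<pi> v - 1) v + 1) = \<pi>"
      using p(2) Suc_pred[OF orderings_pos[OF p(1)]]
      by (auto simp: fun_eq_iff extensional_def restrict_def)
  qed
  show "\<forall>\<sigma>\<in>dominating_orderings (V - {x}) E (I - {x}).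
    (\<lambda>v\<in>V - {x}. (\<lambda>v\<in>V. if v = x then 1 else \<sigma> v + 1) v - 1) = \<sigma>"
    by (auto simp: dominating_orderings_def orderings_def PiE_def extensional_def
        restrict_def fun_eq_iff)
  show "(\<lambda>\<pi>. \<lambda>v\<in>V - {x}. \<pi> v - 1) ` {\<pi> \<in> dominating_orderings V E I. \<pi> x = 1}
    \<subseteq> dominating_orderings (V - {x}) E (I - {x})"
  proof clarify
    fix \<pi> assume d: "\<pi> \<in> dominating_orderings V E I" and x1: "\<pi> x = 1"
    then have p: "\<pi> \<in> orderings V" by (simp add: dominating_orderings_def)
    let ?\<sigma> = "\<lambda>v\<in>V - {x}. \<pi> v - 1"
    have bij: "bij_betw \<pi> V {1..card V}" using p by (simp add: orderings_def)
    have "bij_betw \<pi> (V - {x}) ({1..card V} - {1})"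
      using x1 assms(2) n by (intro bij_betw_DiffI[OF bij]) auto
    moreover have "{1..card V} - {1} = {2..card V}" by auto
    moreover have "bij_betw (\<lambda>i. i - 1) {2..card V} {1..card (V - {x})}"
      by (rule bij_betw_byWitness[where f' = Suc]) (auto simp: n)
    ultimately have "bij_betw ((\<lambda>i. i - 1) \<circ> \<pi>) (V - {x}) {1..card (V - {x})}"
      by (metis bij_betw_trans)
    then have b: "bij_betw ?\<sigma> (V - {x}) {1..card (V - {x})}"
      by (rule bij_betw_cong[THEN iffD1, rotated]) simp
    then have "?\<sigma> \<in> orderings (V - {x})"
      unfolding orderings_def by (auto simp del: restrict_apply intro: bij_betwE[THEN bspec])
    moreover have "?\<sigma> v < ?\<sigma> u"
      if "v \<in> I - {x}" "u \<in> V - {x}" "adjacent E u v" for u v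
    proof -
      have "\<pi> v < \<pi> u" using d that by (auto simp: dominating_orderings_def)
      moreover have "1 < \<pi> v" using gt1[OF p x1, of v] that assms(4) by blast
      ultimately show ?thesis using that assms(4) by auto
    qed
    ultimately show "?\<sigma> \<in> dominating_orderings (V - {x}) E (I - {x})"
      unfolding dominating_orderings_def by blast
  qed
  show "(\<lambda>\<sigma>. \<lambda>v\<in>V. if v = x then 1 else \<sigma> v + 1) ` dominating_orderings (V - {x}) E (I - {x})
    \<subseteq> {\<pi> \<in> dominating_orderings V E I. \<pi> x = 1}"
  proof clarify
    fix \<sigma> assume d: "\<sigma> \<in> dominating_orderings (V - {x}) E (I - {x})"
    then have p: "\<sigma> \<in> orderings (V - {x})" by (simp add: dominating_orderings_def)
    let ?\<pi> = "\<lambda>v\<in>V. if v = x then 1 else \<sigma> v + 1"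
    have "bij_betw \<sigma> (V - {x}) {1..card (V - {x})}" using p by (simp add: orderings_def)
    moreover have "bij_betw Suc {1..card (V - {x})} {2..card V}"
      by (rule bij_betw_byWitness[where f' = "\<lambda>i. i - 1"]) (auto simp: n)
    ultimately have "bij_betw (Suc \<circ> \<sigma>) (V - {x}) {2..card V}" by (rule bij_betw_trans)
    then have "bij_betw ?\<pi> (V - {x}) {2..card V}"
      by (rule bij_betw_cong[THEN iffD1, rotated]) simp
    moreover have "bij_betw ?\<pi> {x} {1}" using assms(2) by (simp add: bij_betw_def)
    ultimately have "bij_betw ?\<pi> ((V - {x}) \<union> {x}) ({2..card V} \<union> {1})"
      by (rule bij_betw_combine) simp
    moreover have "(V - {x}) \<union> {x} = V" using assms(2) by blast
    moreover have "{2..card V} \<union> {1} = {1..card V}" using n by auto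
    ultimately have b: "bij_betw ?\<pi> V {1..card V}" by metis
    then have "?\<pi> \<in> orderings V"
      unfolding orderings_def by (auto simp del: restrict_apply intro: bij_betwE[THEN bspec])
    moreover have "?\<pi> v < ?\<pi> u" if vu: "v \<in> I" "u \<in> V" "adjacent E u v" for u v
    proof -
      have ux: "u \<noteq> x" using assms(3) vu by (auto simp: nbhd_def)
      show ?thesis
      proof (cases "v = x")
        case True
        then show ?thesis using vu ux assms(2) orderings_pos[OF p, of u] by simp
      next
        case False
        then have "\<sigma> v < \<sigma> u" using d vu ux by (auto simp: dominating_orderings_def)
        then show ?thesis using vu ux False assms(4) by auto
      qed
    qed
    ultimately show "?\<pi> \<in> dominating_orderings V E I \<and> ?\<pi> x = 1"
      using assms(2) unfolding dominating_orderings_def by simp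
  qed
qed

section \<open>Counting orderings by recursion on the first vertex\<close>

lemma card_dominating_orderings_first:
  assumes "finite V" "x \<in> V" "x \<notin> nbhd V E I" "I \<subseteq> V"
  shows "card {\<pi> \<in> dominating_orderings V E I. \<pi> x = 1}
       = card (dominating_orderings (V - {x}) E (I - {x}))"
  using bij_betw_dominating_orderings_first[OF assms] by (rule bij_betw_same_card)

text \<open>Some member of \<open>I\<close> must precede \<open>x\<close>, so \<open>x\<close>
  cannot come first.\<close>

lemma card_dominating_orderings_first_nbhd:
  assumes "x \<in> nbhd V E I" "I \<subseteq> V"
  shows "card {\<pi> \<in> dominating_orderings V E I. \<pi> x = 1} = 0"
proof -
  obtain v where v: "v \<in> I" "x \<in> V" "adjacent E x v" using assms(1) by (auto simp: nbhd_def)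
  have "\<pi> x \<noteq> 1" if "\<pi> \<in> dominating_orderings V E I" for \<pi>
  proof -
    have "\<pi> v < \<pi> x" using that v by (auto simp: dominating_orderings_def)
    moreover have "0 < \<pi> v"
      using that v assms(2) by (auto simp: dominating_orderings_def intro: orderings_pos)
    ultimately show ?thesis by simp
  qed
  then have "{\<pi> \<in> dominating_orderings V E I. \<pi> x = 1} = {}" by blast
  then show ?thesis by (simp only: card.empty)
qed

text \<open>With n = m + 1, the a(I) first vertices outside \<open>I\<close> and N(I) contribute m!
  b(I) each. By the recursion for b, those in \<open>I\<close> contribute m! (n - a(I)) b(I)
  together. The terms in a(I) cancel, leaving n! b(I).\<close>

lemma card_dominating_orderings:
  assumes "finite V" "I \<in> independent_sets V E"
  shows "real (card (dominating_orderings V E I)) = fact (card V) * bcoef V E I"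
  using assms
proof (induction "card V" arbitrary: V I)
  case 0
  then have "V = {}" "I = {}" by (auto simp: independent_sets_def)
  \<comment> \<open>Extensionality leaves exactly one ordering of the empty set, matching 0! b({}) =
    1.\<close>
  moreover have "dominating_orderings {} E {} = {\<lambda>_. undefined}"
    by (auto simp: dominating_orderings_def orderings_def bij_betw_def)
  ultimately show ?case by (simp add: bcoef_empty)
next
  case (Suc m)
  let ?N = "nbhd V E I"
  let ?first = "\<lambda>x. {\<pi> \<in> dominating_orderings V E I. \<pi> x = 1}"
  have V: "finite V" "V \<noteq> {}" "card V = Suc m" using Suc by auto
  have I: "I \<subseteq> V" "finite I"
    using Suc.prems finite_subset by (auto simp: independent_sets_def)
  have N: "?N \<subseteq> V" "I \<inter> ?N = {}"
    using independent_sets_disjoint_nbhd[OF Suc.prems(2)] by (auto simp: nbhd_def)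
  have first: "real (card (?first x)) = fact m * bcoef V E (I - {x})" if "x \<in> V - ?N" for x
  proof -
    have "card (V - {x}) = m" using that V by simp
    moreover have "x \<notin> nbhd V E (I - {x})" using that nbhd_mono[of "I - {x}" I V E] by blast
    ultimately show ?thesis
      using that V I Suc.hyps(1)[of "V - {x}" "I - {x}"] independent_sets_Diff[OF Suc.prems(2)]
      by (simp add: card_dominating_orderings_first bcoef_Diff_vertex del: One_nat_def)
  qed
  have "real (card (dominating_orderings V E I)) = (\<Sum>x\<in>V. real (card (?first x)))"
    using card_orderings_by_first[OF V(1,2), of "dominating_orderings V E I"]
    by (simp add: dominating_orderings_def)
  also have "\<dots> = (\<Sum>x\<in>V - ?N. real (card (?first x)))"
    using V I card_dominating_orderings_first_nbhd[of _ V E I]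
    by (intro sum.mono_neutral_right) (auto simp del: One_nat_def)
  also have "\<dots> = (\<Sum>x\<in>V - ?N. fact m * bcoef V E (I - {x}))"
    using first by (intro sum.cong) auto
  also have "V - ?N = (V - I - ?N) \<union> I" using I N by blast
  also have "(\<Sum>x\<in>(V - I - ?N) \<union> I. fact m * bcoef V E (I - {x}))
      = (\<Sum>x\<in>V - I - ?N. fact m * bcoef V E (I - {x})) + (\<Sum>x\<in>I. fact m * bcoef V E (I - {x}))"
    using V I by (intro sum.union_disjoint) auto
  also have "(\<Sum>x\<in>V - I - ?N. fact m * bcoef V E (I - {x})) = acoef V E I * (fact m * bcoef V E I)"
    using card_free_vertices[OF V(1) Suc.prems(2)] by simp
  also have "(\<Sum>x\<in>I. fact m * bcoef V E (I - {x}))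
      = fact m * ((real (card V) - acoef V E I) * bcoef V E I)"
  \<comment> \<open>The recursion for b covers only nonempty \<open>I\<close>, where n - a(I) = |I|
    + |N(I)| is positive. For empty \<open>I\<close> both sides are 0.\<close>
  proof (cases "I = {}")
    case True
    then show ?thesis by (simp add: acoef_def nbhd_def)
  next
    case False
    then have "0 < card I" using I by (simp add: card_gt_0_iff)
    then have "real (card V) - acoef V E I \<noteq> 0" by (simp add: acoef_def)
    then show ?thesis using bcoef_rec[OF False, of V E] by (simp add: sum_distrib_left)
  qed
  also have "acoef V E I * (fact m * bcoef V E I)
      + fact m * ((real (card V) - acoef V E I) * bcoef V E I) = fact (card V) * bcoef V E I"
    unfolding V(3) fact_Suc by (simp add: algebra_simps)
  finally show ?case .
qed

text \<open>In a uniformly random ordering, b(I) is the probability that \<open>I\<close> precedes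
  its neighbours. The factor a(I)/n accounts for the first vertex lying outside
  \<open>I\<close>.\<close>

lemma card_orderings_subset_bad:
  assumes "finite V" "V \<noteq> {}" "I \<in> independent_sets V E"
  shows "real (card {\<pi> \<in> orderings V. I \<subseteq> bad_vertices V E \<pi>}) = fact (card V) * wcoef V E I"
proof -
  let ?N = "nbhd V E I" and ?A = "{\<pi> \<in> orderings V. I \<subseteq> bad_vertices V E \<pi>}"
  have I: "I \<subseteq> V" using assms(3) by (simp add: independent_sets_def)
  obtain m where m: "card V = Suc m" using assms by (metis card_eq_0_iff not0_implies_Suc)
  have A: "?A = {\<pi> \<in> dominating_orderings V E I. \<forall>v\<in>I. \<pi> v \<noteq> 1}"
    using I by (auto simp: bad_vertices_def dominating_orderings_def)
  \<comment> \<open>Once the first vertex is known to be outside \<open>I\<close>, no member of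
    \<open>I\<close> has label 1, so the extra condition in badness is automatic.\<close>
  have uniq: "y = x" if "\<pi> \<in> dominating_orderings V E I" "x \<in> V" "y \<in> V" "\<pi> x = 1" "\<pi> y = 1" for \<pi> x y
    using ordering_first_unique[OF _ assms(2,1)] that by (auto simp: dominating_orderings_def)
  have first: "{\<pi> \<in> ?A. \<pi> x = 1} = (if x \<in> I then {} else {\<pi> \<in> dominating_orderings V E I. \<pi> x = 1})"
    if "x \<in> V" for x
    unfolding A using that I uniq by auto
  have free: "real (card {\<pi> \<in> dominating_orderings V E I. \<pi> x = 1}) = fact m * bcoef V E I"
    if "x \<in> V - I - ?N" for x
  proof -
    have "card (V - {x}) = m" "I - {x} = I" "finite I"
      using that m assms(1) I finite_subset by auto
    then show ?thesis
      using that assms(1) I independent_sets_Diff[OF assms(3), of x]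
      by (simp add: card_dominating_orderings_first card_dominating_orderings bcoef_Diff_vertex
          del: One_nat_def)
  qed
  have "real (card ?A) = (\<Sum>x\<in>V. real (card {\<pi> \<in> ?A. \<pi> x = 1}))"
    using card_orderings_by_first[OF assms(1,2), of ?A] by simp
  also have "\<dots> = (\<Sum>x\<in>V - I - ?N. real (card {\<pi> \<in> ?A. \<pi> x = 1}))"
    using assms(1) first card_dominating_orderings_first_nbhd[OF _ I, of _ E]
    by (intro sum.mono_neutral_right) (auto simp del: One_nat_def)
  also have "\<dots> = (\<Sum>x\<in>V - I - ?N. fact m * bcoef V E I)"
    using first free by (intro sum.cong) auto
  also have "\<dots> = acoef V E I * (fact m * bcoef V E I)"
    using card_free_vertices[OF assms(1,3)] by simp
  also have "\<dots> = fact (card V) * wcoef V E I"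
    unfolding wcoef_def m fact_Suc by (simp add: field_simps del: of_nat_Suc)
  finally show ?thesis .
qed

section \<open>From counts to the polynomial and its Taylor coefficients\<close>

lemma bad_vertices_independent: "bad_vertices V E \<pi> \<in> independent_sets V E"
  \<comment> \<open>Of two adjacent bad vertices, each would need the smaller label.\<close>
  unfolding bad_vertices_def independent_sets_def
  by (auto dest: adjacent_commute[THEN iffD1] less_asym)

text \<open>Expand the product of \<open>card B\<close> factors x + 1: the factors from which x is
  chosen form the subset \<open>I\<close>.\<close>

lemma sum_Pow_monom:
  assumes "finite B"
  shows "(\<Sum>I\<in>Pow B. monom (1 :: 'b :: comm_semiring_1) (card I)) = [:1, 1:] ^ card B"
proof -
  have "[:1, 1:] ^ card B = (\<Prod>_\<in>B. monom (1 :: 'b) 1 + 1)"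
    by (simp add: monom_altdef one_pCons)
  also have "\<dots> = (\<Sum>I\<in>Pow B. (\<Prod>_\<in>I. monom 1 1) * (\<Prod>_\<in>B - I. 1))"
    using assms by (rule prod_add)
  finally show ?thesis by (simp add: monom_power)
qed

lemma successive_poly_eq_sum_orderings:
  assumes "finite V" "V \<noteq> {}"
  shows "smult (fact (card V)) (successive_poly V E)
       = (\<Sum>\<pi>\<in>orderings V. [:1, 1:] ^ card (bad_vertices V E \<pi>))"
proof -
  let ?bad = "bad_vertices V E"
  have fin: "finite (?bad \<pi>)" for \<pi> using assms(1) by (simp add: bad_vertices_def)
  have "smult (fact (card V)) (successive_poly V E)
      = (\<Sum>I\<in>independent_sets V E. monom (real (card {\<pi> \<in> orderings V. I \<subseteq> ?bad \<pi>})) (card I))"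
    using assms
    by (intro poly_eqI) (simp add: successive_poly_def coeff_sum sum_distrib_left
        card_orderings_subset_bad if_distrib cong: if_cong)
  \<comment> \<open>Each count is spread into one monomial per ordering, ready for the exchange of
    sums.\<close>
  also have "\<dots> = (\<Sum>I\<in>independent_sets V E. \<Sum>\<pi> | \<pi> \<in> orderings V \<and> I \<subseteq> ?bad \<pi>. monom 1 (card I))"
    by (simp add: of_nat_mult_conv_smult smult_monom)
  also have "\<dots> = (\<Sum>\<pi>\<in>orderings V. \<Sum>I | I \<in> independent_sets V E \<and> I \<subseteq> ?bad \<pi>. monom 1 (card I))"
    using finite_independent_sets[OF assms(1)] finite_orderings[OF assms(1)]
    by (rule sum.swap_restrict)
  \<comment> \<open>Independence passes to subsets, so every subset of a bad set occurs.\<close>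
  also have "\<dots> = (\<Sum>\<pi>\<in>orderings V. \<Sum>I\<in>Pow (?bad \<pi>). monom 1 (card I))"
    using independent_sets_mono[OF bad_vertices_independent]
    by (intro sum.cong) auto
  finally show ?thesis by (simp add: sum_Pow_monom fin)
qed

text \<open>About -1, the polynomial (1 + x)^m is a single Taylor term. Differentiating lowers
  \<open>m\<close> and \<open>k\<close> together, hence the induction with \<open>m\<close>
  arbitrary.\<close>

lemma poly_higher_pderiv_linear_power:
  "poly ((pderiv ^^ k) ([:1, 1:] ^ m)) (- 1 :: real) = (if m = k then fact k else 0)"
proof (induction k arbitrary: m)
  case 0
  then show ?case by (simp add: poly_power)
next
  case (Suc k)
  show ?case
  proof (cases m)
    case 0
    then show ?thesis by (simp add: funpow_Suc_right del: funpow.simps)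
  next
    case (Suc l)
    then have "pderiv ([:1, 1:] ^ m) = smult (real m) ([:1, 1:] ^ l)"
      by (simp only: pderiv_power_Suc) (simp add: pderiv_pCons)
    then show ?thesis
      using Suc Suc.IH[of l] by (simp add: funpow_Suc_right higher_pderiv_smult del: funpow.simps)
  qed
qed

theorem theorem5p3:
  fixes V :: "'a set" and E :: "'a set set" and F :: "real poly"
  assumes "finite_graph V E" and "card V \<ge> 1"
    and "F = smult (fact (card V)) (successive_poly V E)"
  shows "(\<forall>k. real (num_orderings_bad V E k) = poly ((pderiv ^^ k) F) (-1) / fact k)
         \<and> num_orderings_bad V E 0 = num_successive V E"
proof (intro conjI allI)
  have V: "finite V" "V \<noteq> {}"
    using assms(1,2) by (auto simp: finite_graph_def)
  fix k
  have "poly ((pderiv ^^ k) F) (-1)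
      = (\<Sum>\<pi>\<in>orderings V. poly ((pderiv ^^ k) ([:1, 1:] ^ card (bad_vertices V E \<pi>))) (-1))"
    unfolding assms(3) successive_poly_eq_sum_orderings[OF V] by (simp add: higher_pderiv_sum poly_sum)
  \<comment> \<open>Only orderings with exactly \<open>k\<close> bad vertices survive, each
    contributing k!.\<close>
  also have "\<dots> = fact k * real (num_orderings_bad V E k)"
    using finite_orderings[OF V(1)]
    by (simp add: poly_higher_pderiv_linear_power num_orderings_bad_def sum.If_cases Int_def)
  finally show "real (num_orderings_bad V E k) = poly ((pderiv ^^ k) F) (-1) / fact k"
    by simp
next
  \<comment> \<open>As \<open>card\<close> is also 0 on infinite sets, finiteness is what turns
    cardinality 0 into emptiness.\<close>
  have "finite (bad_vertices V E \<pi>)" for \<pi>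
    using assms(1) by (simp add: finite_graph_def bad_vertices_def)
  then show "num_orderings_bad V E 0 = num_successive V E"
    by (simp add: num_orderings_bad_def num_successive_def successive_def)
qed

end
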